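(* Let $K$ be an algebraically closed field of characteristic zero and let $n \geq 1$. The triangular subalgebra $u_n(K) = P_0\partial_1 + P_1\partial_2 + \cdots + P_{n-1}\partial_n$ is a maximal locally nilpotent subalgebra of the Lie algebra $W_n(K)$; that is, $u_n(K)$ is a locally nilpotent subalgebra of $W_n(K)$ and there is no locally nilpotent Lie subalgebra $S$ of $W_n(K)$ that properly contains $u_n(K)$.
   Context: For $1 \leq i \leq n$, $P_i = K[x_1,\ldots,x_i]$ is the polynomial ring, and $P_0 = K$; all $P_i$ are regarded as subrings of $P_n = K[x_1,\ldots,x_n]$. $W_n(K)$ is the Lie algebra over $K$ of all $K$-derivations of $P_n$, with bracket $[D_1,D_2] = D_1D_2 - D_2D_1$. Its elements are uniquely of the form $f_1\partial_1 + \cdots + f_n\partial_n$ with $f_i \in P_n$, where $\partial_i = \partial/\partial x_i$. Thus $u_n(K)$ consists of all $f_1\partial_1+\cdots+f_n\partial_n$ with $f_i \in P_{i-1}$ for $i=1,\ldots,n$. A Lie algebra is locally nilpotent if each of its finitely generated subalgebras is nilpotent. (This is a condition on the Lie algebra, and differs from the notion of a locally nilpotent derivation of $P_n$.) *)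

theory Defs
  imports
    "HOL-Library.Poly_Mapping"
    "HOL-Library.Function_Algebras"
    "HOL-Computational_Algebra.Polynomial"
begin

text \<open>
  A Lie algebra over a field. The carrier \<open>L\<close> is a subspace of an ambient vector space; the bracket only has to
  satisfy the Lie algebra axioms on \<open>L\<close>.
\<close>

locale lie_algebra = vector_space scale
  for scale :: "'k::field \<Rightarrow> 'l::ab_group_add \<Rightarrow> 'l"  (infixr \<open>*s\<close> 75) +
  fixes L :: "'l set" and bracket :: "'l \<Rightarrow> 'l \<Rightarrow> 'l"
  assumes subspace_carrier: "subspace L"
    and bracket_closed: "\<lbrakk>x \<in> L; y \<in> L\<rbrakk> \<Longrightarrow> bracket x y \<in> L"
    and bracket_add_left:
      "\<lbrakk>x \<in> L; y \<in> L; z \<in> L\<rbrakk> \<Longrightarrow> bracket (x + y) z = bracket x z + bracket y z"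
    and bracket_add_right:
      "\<lbrakk>x \<in> L; y \<in> L; z \<in> L\<rbrakk> \<Longrightarrow> bracket x (y + z) = bracket x y + bracket x z"
    and bracket_scale_left:
      "\<lbrakk>x \<in> L; y \<in> L\<rbrakk> \<Longrightarrow> bracket (c *s x) y = c *s bracket x y"
    and bracket_scale_right:
      "\<lbrakk>x \<in> L; y \<in> L\<rbrakk> \<Longrightarrow> bracket x (c *s y) = c *s bracket x y"
    and bracket_self: "x \<in> L \<Longrightarrow> bracket x x = 0"
    and jacobi: "\<lbrakk>x \<in> L; y \<in> L; z \<in> L\<rbrakk> \<Longrightarrow>
      bracket x (bracket y z) + bracket y (bracket z x) + bracket z (bracket x y) = 0"
begin

definition subalgebra :: "'l set \<Rightarrow> bool" where
  "subalgebra S \<longleftrightarrow> S \<subseteq> L \<and> subspace S \<and> (\<forall>x\<in>S. \<forall>y\<in>S. bracket x y \<in> S)"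

definition generated :: "'l set \<Rightarrow> 'l set" where
  "generated X = subalgebra hull X"

primrec lower_central :: "'l set \<Rightarrow> nat \<Rightarrow> 'l set" where
  "lower_central S 0 = S"
| "lower_central S (Suc k) = span {bracket x y | x y. x \<in> S \<and> y \<in> lower_central S k}"

definition nilpotent :: "'l set \<Rightarrow> bool" where
  "nilpotent S \<longleftrightarrow> (\<exists>k. lower_central S k = {0})"

definition locally_nilpotent :: "'l set \<Rightarrow> bool" where
  "locally_nilpotent S \<longleftrightarrow> (\<forall>X. finite X \<and> X \<subseteq> S \<longrightarrow> nilpotent (generated X))"

end

text \<open>
  Polynomials in variables indexed by \<open>nat\<close> are finitely supported functions from monomials
  (exponent vectors) to coefficients. The variables of interest are \<open>x\<^sub>1, x\<^sub>2, \<dots>\<close>;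
  index 0 is never used.
\<close>

type_synonym 'k mpoly = "(nat \<Rightarrow>\<^sub>0 nat) \<Rightarrow>\<^sub>0 'k"

definition polys :: "nat \<Rightarrow> 'k::field mpoly set" where
  "polys i = {p. \<forall>m\<in>Poly_Mapping.keys p. Poly_Mapping.keys m \<subseteq> {1..i}}"

definition pscale :: "'k::field \<Rightarrow> 'k mpoly \<Rightarrow> 'k mpoly" where
  "pscale c p = Poly_Mapping.single 0 c * p"

text \<open>
  If \<open>x\<^sub>i\<close> does not occur in \<open>m\<close>, the exponent subtraction truncates, but the coefficient
  factor \<open>lookup m i\<close> is zero.
\<close>

definition partial :: "nat \<Rightarrow> 'k::field mpoly \<Rightarrow> 'k mpoly" where
  "partial i p = (\<Sum>m\<in>Poly_Mapping.keys p.
     Poly_Mapping.single (m - Poly_Mapping.single i 1)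
       (of_nat (Poly_Mapping.lookup m i) * Poly_Mapping.lookup p m))"

text \<open>
  A map \<open>P\<^sub>n \<rightarrow> P\<^sub>n\<close> is represented by its extension by zero to all of \<open>'k mpoly\<close>. This makes
  equality of such maps equality of functions, and is preserved by pointwise addition and
  scaling and by the commutator.
\<close>

definition derivations :: "nat \<Rightarrow> ('k::field mpoly \<Rightarrow> 'k mpoly) set" where
  "derivations n = {D.
     (\<forall>p\<in>polys n. D p \<in> polys n) \<and>
     (\<forall>p. p \<notin> polys n \<longrightarrow> D p = 0) \<and>
     (\<forall>p\<in>polys n. \<forall>q\<in>polys n. D (p + q) = D p + D q) \<and>
     (\<forall>c. \<forall>p\<in>polys n. D (pscale c p) = pscale c (D p)) \<and>
     (\<forall>p\<in>polys n. \<forall>q\<in>polys n. D (p * q) = D p * q + p * D q)}"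

definition oscale :: "'k::field \<Rightarrow> ('k mpoly \<Rightarrow> 'k mpoly) \<Rightarrow> 'k mpoly \<Rightarrow> 'k mpoly" where
  "oscale c D = (\<lambda>p. pscale c (D p))"

definition commutator ::
    "('k::field mpoly \<Rightarrow> 'k mpoly) \<Rightarrow> ('k mpoly \<Rightarrow> 'k mpoly) \<Rightarrow> 'k mpoly \<Rightarrow> 'k mpoly" where
  "commutator D E = (\<lambda>p. D (E p) - E (D p))"

definition vector_field :: "nat \<Rightarrow> (nat \<Rightarrow> 'k::field mpoly) \<Rightarrow> 'k mpoly \<Rightarrow> 'k mpoly" where
  "vector_field n f = (\<lambda>p. if p \<in> polys n then \<Sum>i=1..n. f i * partial i p else 0)"

definition triangular :: "nat \<Rightarrow> ('k::field mpoly \<Rightarrow> 'k mpoly) set" where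
  "triangular n = {vector_field n f | f. \<forall>i\<in>{1..n}. f i \<in> polys (i - 1)}"

lemma polys_0 [simp]: "0 \<in> polys n"
  by (simp add: polys_def)

lemma polys_add: "p \<in> polys n \<Longrightarrow> q \<in> polys n \<Longrightarrow> p + q \<in> polys n"
  using Poly_Mapping.keys_add[of p q] unfolding polys_def by blast

lemma polys_diff: "p \<in> polys n \<Longrightarrow> q \<in> polys n \<Longrightarrow> p - q \<in> polys n"
  using Poly_Mapping.keys_diff[of p q] unfolding polys_def by blast

lemma polys_mult:
  assumes "p \<in> polys n" "q \<in> polys n"
  shows "p * q \<in> polys n"
  unfolding polys_def mem_Collect_eq
proof
  fix m assume "m \<in> Poly_Mapping.keys (p * q)"
  then obtain a b where ab: "m = a + b" "a \<in> Poly_Mapping.keys p" "b \<in> Poly_Mapping.keys q"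
    using Poly_Mapping.keys_mult[of p q] by fast
  then have "Poly_Mapping.keys a \<subseteq> {1..n}" "Poly_Mapping.keys b \<subseteq> {1..n}"
    using assms by (simp_all add: polys_def)
  then show "Poly_Mapping.keys m \<subseteq> {1..n}"
    using Poly_Mapping.keys_add[of a b] ab(1) by (metis Un_least order_trans)
qed

lemma polys_const: "Poly_Mapping.single 0 c \<in> polys n"
  by (simp add: polys_def)

lemma polys_pscale: "p \<in> polys n \<Longrightarrow> pscale c p \<in> polys n"
  by (simp add: pscale_def polys_mult polys_const)

lemma vector_space_oscale:
  "vector_space (oscale :: 'k::field \<Rightarrow> ('k mpoly \<Rightarrow> 'k mpoly) \<Rightarrow> _)"
proof
  fix a b :: 'k and D E :: "'k mpoly \<Rightarrow> 'k mpoly"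
  show "oscale a (D + E) = oscale a D + oscale a E"
    by (simp add: oscale_def pscale_def fun_eq_iff distrib_left)
  show "oscale (a + b) D = oscale a D + oscale b D"
    by (simp add: oscale_def pscale_def fun_eq_iff distrib_right single_add)
  show "oscale a (oscale b D) = oscale (a * b) D"
    by (simp add: oscale_def pscale_def fun_eq_iff mult_single flip: mult.assoc)
  show "oscale 1 D = D"
    by (simp add: oscale_def pscale_def fun_eq_iff)
qed

lemma derivations_0: "0 \<in> derivations n"
  by (simp add: derivations_def pscale_def)

lemma derivations_add: "D \<in> derivations n \<Longrightarrow> E \<in> derivations n \<Longrightarrow> D + E \<in> derivations n"
  by (auto simp: derivations_def polys_add pscale_def distrib_left distrib_right add_ac)

lemma derivations_oscale: "D \<in> derivations n \<Longrightarrow> oscale c D \<in> derivations n"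
  by (auto simp: derivations_def polys_pscale oscale_def)
    (simp_all add: pscale_def distrib_left mult_ac)

lemma derivation_0: "D \<in> derivations n \<Longrightarrow> D 0 = 0"
proof -
  assume "D \<in> derivations n"
  then have "D (0 + 0) = D 0 + D 0"
    unfolding derivations_def using polys_0 by blast
  then have "D 0 = D 0 + D 0"
    by (simp only: add_0_left)
  then show ?thesis
    by (simp only: add_cancel_right_right)
qed

lemma derivation_diff:
  assumes "D \<in> derivations n" "p \<in> polys n" "q \<in> polys n"
  shows "D (p - q) = D p - D q"
proof -
  have "D ((p - q) + q) = D (p - q) + D q"
    using assms polys_diff[of p n q] unfolding derivations_def by blast
  then show ?thesis by (simp add: algebra_simps)
qed

lemma derivation_in: "D \<in> derivations n \<Longrightarrow> D p \<in> polys n"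
  by (cases "p \<in> polys n") (auto simp: derivations_def)

lemma commutator_derivations:
  fixes D E :: "'k::field mpoly \<Rightarrow> 'k mpoly"
  assumes D: "D \<in> derivations n" and E: "E \<in> derivations n"
  shows "commutator D E \<in> derivations n"
proof -
  have add: "F (p + q) = F p + F q" and mult: "F (p * q) = F p * q + p * F q"
    if "F \<in> derivations n" "p \<in> polys n" "q \<in> polys n" for F and p q :: "'k mpoly"
    using that by (auto simp: derivations_def)
  have scale: "F (pscale c p) = pscale c (F p)" if "F \<in> derivations n" "p \<in> polys n" 
      for F c and p :: "'k mpoly"
    using that by (auto simp: derivations_def)
  have out: "F p = 0" if "F \<in> derivations n" "p \<notin> polys n" for F and p :: "'k mpoly"
    using that by (auto simp: derivations_def)
  note ins = derivation_in[OF D] derivation_in[OF E]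
  show ?thesis
    unfolding derivations_def mem_Collect_eq
  proof (intro conjI ballI allI impI)
    fix p :: "'k mpoly" show "commutator D E p \<in> polys n"
      by (simp add: commutator_def polys_diff ins)
  next
    fix p :: "'k mpoly" assume "p \<notin> polys n"
    then show "commutator D E p = 0"
      by (simp add: commutator_def out D E derivation_0[OF D] derivation_0[OF E])
  next
    fix p q :: "'k mpoly" assume "p \<in> polys n" "q \<in> polys n"
    then show "commutator D E (p + q) = commutator D E p + commutator D E q"
      by (simp add: commutator_def add D E ins)
  next
    fix c and p :: "'k mpoly" assume "p \<in> polys n"
    then show "commutator D E (pscale c p) = pscale c (commutator D E p)"
      by (simp add: commutator_def scale D E ins) (simp add: pscale_def right_diff_distrib)
  next
    fix p q :: "'k mpoly" assume "p \<in> polys n" "q \<in> polys n"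
    then show "commutator D E (p * q) = commutator D E p * q + p * commutator D E q"
      by (simp add: commutator_def add mult polys_mult D E ins) (simp add: algebra_simps)
  qed
qed

interpretation W: lie_algebra oscale "derivations n :: ('k::field mpoly \<Rightarrow> 'k mpoly) set" commutator
  for n
proof (intro lie_algebra.intro lie_algebra_axioms.intro vector_space_oscale)
  interpret vector_space "oscale :: 'k \<Rightarrow> ('k mpoly \<Rightarrow> 'k mpoly) \<Rightarrow> _"
    by (rule vector_space_oscale)
  show "subspace (derivations n :: ('k mpoly \<Rightarrow> 'k mpoly) set)"
    by (intro subspaceI derivations_0 derivations_add derivations_oscale)
next
  fix D E :: "'k mpoly \<Rightarrow> 'k mpoly"
  assume "D \<in> derivations n" "E \<in> derivations n"
  then show "commutator D E \<in> derivations n"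
    by (rule commutator_derivations)
next
  fix D E F :: "'k mpoly \<Rightarrow> 'k mpoly"
  assume D: "D \<in> derivations n" and E: "E \<in> derivations n" and F: "F \<in> derivations n"
  have add: "G (D p + E p) = G (D p) + G (E p)" "G (E p + F p) = G (E p) + G (F p)"
    if "G \<in> derivations n" for G and p :: "'k mpoly"
    using that derivation_in[OF D, of p] derivation_in[OF E, of p] derivation_in[OF F, of p]
    unfolding derivations_def by blast+
  have diff: "G (H p - I q) = G (H p) - G (I q)"
    if "G \<in> derivations n" "H \<in> derivations n" "I \<in> derivations n"
    for G H I and p q :: "'k mpoly"
    using that derivation_in derivation_diff by blast
  show "commutator (D + E) F = commutator D F + commutator E F"
    by (simp add: commutator_def fun_eq_iff add F)
  show "commutator D (E + F) = commutator D E + commutator D F"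
    by (simp add: commutator_def fun_eq_iff add D)
  show "commutator D (commutator E F) + commutator E (commutator F D)
      + commutator F (commutator D E) = 0"
    by (simp add: commutator_def fun_eq_iff diff D E F)
next
  fix D E :: "'k mpoly \<Rightarrow> 'k mpoly" and c
  assume D: "D \<in> derivations n" and E: "E \<in> derivations n"
  have scale: "G (pscale c (H p)) = pscale c (G (H p))"
    if "G \<in> derivations n" "H \<in> derivations n" for G H and p :: "'k mpoly"
    using that(1) derivation_in[OF that(2), of p] unfolding derivations_def by blast
  show "commutator (oscale c D) E = oscale c (commutator D E)"
    by (simp add: commutator_def oscale_def fun_eq_iff scale D E)
      (simp add: pscale_def right_diff_distrib)
  show "commutator D (oscale c E) = oscale c (commutator D E)"
    by (simp add: commutator_def oscale_def fun_eq_iff scale D E)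
      (simp add: pscale_def right_diff_distrib)
next
  fix D :: "'k mpoly \<Rightarrow> 'k mpoly"
  show "commutator D D = 0"
    by (simp add: commutator_def fun_eq_iff)
qed

end

theory Submission
  imports Defs
begin

text \<open>
  A finite set of triangular derivations becomes strictly weight-decreasing once the weights
  \<open>w\<^sub>1, w\<^sub>2, \<dots>\<close> are chosen to grow fast enough. The derivations lowering weights by at least \<open>d\<close>
  form a Lie algebra filtration which vanishes for large \<open>d\<close>, so the generated algebra is nilpotent.

  For maximality, take \<open>D \<in> S - U\<close> of least total degree. Then \<open>[D, \<partial>\<^sub>k] \<in> U\<close> for all \<open>k\<close>, which
  forces every nontriangular monomial of \<open>D x\<^sub>j\<close> to be a single variable \<open>x\<^sub>i\<close> with \<open>i \<ge> j\<close>.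
  Modulo \<open>U\<close> we get \<open>E \<in> S\<close> with \<open>E x\<^sub>j = \<Sum>i\<ge>j. a i j x\<^sub>i\<close>, not all \<open>a i j\<close> zero.
  Let \<open>k\<close> be least with some \<open>a k j \<noteq> 0\<close>. If \<open>a k k \<noteq> 0\<close>, then \<open>[E, \<partial>\<^sub>k]\<close> is an eigenvector of
  \<open>ad E\<close> for the eigenvalue \<open>- a k k\<close>. Otherwise \<open>a k l \<noteq> 0\<close> for some \<open>l < k\<close>, and \<open>\<partial>\<^sub>k\<close> is an
  eigenvector of \<open>(ad (E + x\<^sub>l \<partial>\<^sub>k))\<^sup>2\<close> for the eigenvalue \<open>a k l\<close>. Neither can happen in a locally
  nilpotent algebra.
\<close>

section \<open>Nilpotency criteria in an abstract Lie algebra\<close>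

context lie_algebra
begin

lemma subalgebra_carrier: "subalgebra L"
  by (auto simp: subalgebra_def subspace_carrier bracket_closed)

lemma subalgebra_generated:
  assumes "X \<subseteq> L"
  shows "subalgebra (generated X)"
proof -
  have "subspace (generated X)"
    unfolding generated_def hull_def
    by (rule subspace_Inter) (auto simp: subalgebra_def)
  moreover have "generated X \<subseteq> L"
    unfolding generated_def by (rule hull_minimal) (auto simp: assms subalgebra_carrier)
  moreover have "\<forall>x\<in>generated X. \<forall>y\<in>generated X. bracket x y \<in> generated X"
    unfolding generated_def hull_def by (auto simp: subalgebra_def)
  ultimately show ?thesis
    by (simp add: subalgebra_def)
qed

lemma subspace_lower_central: "subspace A \<Longrightarrow> subspace (lower_central A k)"
  by (cases k) auto

lemma bracket_in_lower_central:
  "x \<in> A \<Longrightarrow> y \<in> lower_central A k \<Longrightarrow> bracket x y \<in> lower_central A (Suc k)"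
  by (auto intro!: span_base)

text \<open>Filtration degrees add under the bracket and \<open>A\<close> sits in degree 1, so each
  step down the lower central series gains one degree: term \<open>k\<close> lies in
  \<open>F (Suc k)\<close>.\<close>

lemma nilpotent_filtration:
  assumes sub: "\<And>d. subspace (F d)"
    and br: "\<And>d e x y. x \<in> F d \<Longrightarrow> y \<in> F e \<Longrightarrow> bracket x y \<in> F (d + e)"
    and "subspace A" "A \<subseteq> F 1" "F (Suc N) = {0}"
  shows "nilpotent A"
proof -
  have "lower_central A k \<subseteq> F (Suc k)" for k
  proof (induction k)
    case 0
    then show ?case using assms by simp
  next
    case (Suc k)
    show ?case
      unfolding lower_central.simps
    proof (rule span_minimal[OF _ sub])
      show "{bracket x y |x y. x \<in> A \<and> y \<in> lower_central A k} \<subseteq> F (Suc (Suc k))"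
        using br[of _ 1 _ "Suc k"] \<open>A \<subseteq> F 1\<close> Suc by fastforce
    qed
  qed
  then have "lower_central A N = {0}"
    using assms subspace_0[OF subspace_lower_central[OF \<open>subspace A\<close>]] by blast
  then show ?thesis
    by (auto simp: nilpotent_def)
qed

text \<open>An eigenvector of the square of \<open>ad x\<close> for a nonzero eigenvalue never
  leaves the lower central series. Working with the square serves both eigenvectors that arise in
  the maximality proof.\<close>

lemma nilpotent_ad2_eigen:
  assumes "nilpotent A" "subalgebra A" "x \<in> A" "y \<in> A"
    and eig: "bracket x (bracket x y) = c *s y" and "c \<noteq> 0"
  shows "y = 0"
proof -
  have sub: "subspace (lower_central A k)" for k
    using assms by (intro subspace_lower_central) (simp add: subalgebra_def)
  \<comment> \<open>The two memberships feed each other: \<open>y\<close> in term \<open>k\<close>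
    puts \<open>bracket x y\<close> in the next term, and \<open>bracket x y\<close> in term
    \<open>k\<close> puts \<open>c *s y\<close> there, hence \<open>y\<close> after division by
    \<open>c\<close>.\<close>
  have "y \<in> lower_central A k \<and> bracket x y \<in> lower_central A k" for k
  proof (induction k)
    case 0
    then show ?case using assms by (simp add: subalgebra_def)
  next
    case (Suc k)
    then have "bracket x y \<in> lower_central A (Suc k)"
      and "c *s y \<in> lower_central A (Suc k)"
      using bracket_in_lower_central[OF \<open>x \<in> A\<close>] eig by metis+
    moreover from this(2) have "inverse c *s (c *s y) \<in> lower_central A (Suc k)"
      by (rule subspace_scale[OF sub])
    ultimately show ?case
      using \<open>c \<noteq> 0\<close> by simp
  qed
  then show ?thesis
    using \<open>nilpotent A\<close> by (metis nilpotent_def singletonD)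
qed

lemma locally_nilpotent_ad2_eigen:
  assumes "subalgebra S" "locally_nilpotent S" "x \<in> S" "y \<in> S"
    and "bracket x (bracket x y) = c *s y" "c \<noteq> 0"
  shows "y = 0"
proof (rule nilpotent_ad2_eigen)
  show "nilpotent (generated {x, y})"
    using assms by (auto simp: locally_nilpotent_def)
  show "subalgebra (generated {x, y})"
    using assms by (intro subalgebra_generated) (auto simp: subalgebra_def)
  show "x \<in> generated {x, y}" "y \<in> generated {x, y}"
    by (auto simp: generated_def intro: hull_inc)
qed (use assms in auto)

end

subsection \<open>Partial derivatives\<close>

definition var :: "nat \<Rightarrow> 'k::field mpoly" where
  "var i = Poly_Mapping.single (Poly_Mapping.single i 1) 1"

lemma var_in_polys: "i \<in> {1..n} \<Longrightarrow> var i \<in> polys n"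
  by (simp add: var_def polys_def)

lemma one_in_polys [simp]: "1 \<in> polys n"
  by (simp add: polys_def)

lemma polysD: "p \<in> polys n \<Longrightarrow> m \<in> Poly_Mapping.keys p \<Longrightarrow> Poly_Mapping.keys m \<subseteq> {1..n}"
  by (simp add: polys_def)

lemma polys_mono: "i \<le> j \<Longrightarrow> polys i \<subseteq> polys j"
  by (fastforce simp: polys_def)

lemma polys_sum: "(\<And>i. i \<in> A \<Longrightarrow> f i \<in> polys n) \<Longrightarrow> sum f A \<in> polys n"
  by (induction A rule: infinite_finite_induct) (auto simp: polys_add)

lemma lookup_pscale: "Poly_Mapping.lookup (pscale c p) m = c * Poly_Mapping.lookup p m"
  unfolding pscale_def mult_map_scale_conv_mult[symmetric]
  by (simp add: Poly_Mapping.map.rep_eq when_def)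

lemma keys_pscale: "Poly_Mapping.keys (pscale c p) \<subseteq> Poly_Mapping.keys p"
  by (auto simp: in_keys_iff lookup_pscale)

lemma mpoly_eq_sum_single:
  "p = (\<Sum>m\<in>Poly_Mapping.keys p. Poly_Mapping.single m (Poly_Mapping.lookup p m))"
  by (rule poly_mapping_eqI)
    (simp add: lookup_sum lookup_single when_def in_keys_iff)

lemma mpoly_induct [case_names single add]:
  fixes p :: "'a::zero \<Rightarrow>\<^sub>0 'b::comm_monoid_add"
  assumes "\<And>m c. P (Poly_Mapping.single m c)" and "\<And>p q. P p \<Longrightarrow> P q \<Longrightarrow> P (p + q)"
  shows "P p"
proof -
  have "P (\<Sum>m\<in>A. Poly_Mapping.single m (Poly_Mapping.lookup p m))" for A
  proof (induction A rule: infinite_finite_induct)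
    case (insert m A)
    then show ?case using assms by simp
  qed (use assms(1)[of 0 0] in auto)
  then show ?thesis
    by (subst mpoly_eq_sum_single)
qed

lemma partial_single:
  "partial i (Poly_Mapping.single m c) =
    Poly_Mapping.single (m - Poly_Mapping.single i 1) (of_nat (Poly_Mapping.lookup m i) * c)"
  by (cases "c = 0") (simp_all add: partial_def)

text \<open>Coefficientwise form of differentiation: only the monomial
  \<open>m + Poly_Mapping.single i 1\<close> can contribute to the coefficient of \<open>m\<close>.
  Linearity then follows by comparing coefficients.\<close>

lemma lookup_partial:
  "Poly_Mapping.lookup (partial i p) m =
    of_nat (Suc (Poly_Mapping.lookup m i)) * Poly_Mapping.lookup p (m + Poly_Mapping.single i 1)"
proof -
  \<comment> \<open>A nonzero exponent at \<open>i\<close> rules out monomials that truncated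
    subtraction leaves unchanged; those have coefficient factor zero anyway.\<close>
  have *: "(m' - Poly_Mapping.single i 1 = m \<and> Poly_Mapping.lookup m' i \<noteq> 0) \<longleftrightarrow>
      m' = m + Poly_Mapping.single i 1" for m'
    by (auto simp: poly_mapping_eq_iff fun_eq_iff lookup_add lookup_minus lookup_single when_def
        split: if_splits)
  have "Poly_Mapping.lookup (partial i p) m = (\<Sum>m'\<in>Poly_Mapping.keys p.
      if m' = m + Poly_Mapping.single i 1
      then of_nat (Suc (Poly_Mapping.lookup m i)) * Poly_Mapping.lookup p m' else 0)"
    unfolding partial_def lookup_sum
  proof (rule sum.cong)
    fix m'
    show "Poly_Mapping.lookup (Poly_Mapping.single (m' - Poly_Mapping.single i 1)
        (of_nat (Poly_Mapping.lookup m' i) * Poly_Mapping.lookup p m')) m =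
      (if m' = m + Poly_Mapping.single i 1
       then of_nat (Suc (Poly_Mapping.lookup m i)) * Poly_Mapping.lookup p m' else 0)"
      using *[of m']
      by (cases "Poly_Mapping.lookup m' i = 0") (auto simp: lookup_single when_def lookup_add)
  qed simp
  then show ?thesis
    by (simp add: in_keys_iff)
qed

lemma partial_add: "partial i (p + q) = partial i p + partial i q"
  by (rule poly_mapping_eqI) (simp add: lookup_partial lookup_add distrib_left)

lemma partial_pscale: "partial i (pscale c p) = pscale c (partial i p)"
  by (rule poly_mapping_eqI) (simp add: lookup_partial lookup_pscale)

lemma partial_sum: "partial i (sum f A) = (\<Sum>j\<in>A. partial i (f j))"
  by (rule poly_mapping_eqI) (simp add: lookup_partial lookup_sum sum_distrib_left)

lemma partial_0 [simp]: "partial i 0 = 0"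
  by (rule poly_mapping_eqI) (simp add: lookup_partial)

lemma partial_var: "partial i (var j) = (if i = j then 1 else 0)"
  by (simp add: var_def partial_single lookup_single)

lemma partial_single_mult:
  "partial i (Poly_Mapping.single a c * Poly_Mapping.single b d) =
    partial i (Poly_Mapping.single a c) * Poly_Mapping.single b d +
    Poly_Mapping.single a c * partial i (Poly_Mapping.single b d)"
proof -
  let ?e = "Poly_Mapping.single i (Suc 0) :: nat \<Rightarrow>\<^sub>0 nat"
  \<comment> \<open>Truncated subtraction can be moved across the product only when the exponent at
    \<open>i\<close> is positive; if it is zero, the corresponding Leibniz term vanishes.\<close>
  have 1: "a - ?e + b = a + b - ?e" if "Poly_Mapping.lookup a i \<noteq> 0" for a b :: "nat \<Rightarrow>\<^sub>0 nat"
    using that by (intro poly_mapping_eqI) (auto simp: lookup_add lookup_minus lookup_single when_def)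
  have 2: "a + (b - ?e) = a + b - ?e" if "Poly_Mapping.lookup b i \<noteq> 0" for a b :: "nat \<Rightarrow>\<^sub>0 nat"
    using 1[OF that, of a] by (simp add: add.commute)
  show ?thesis
    by (cases "Poly_Mapping.lookup a i = 0"; cases "Poly_Mapping.lookup b i = 0")
      (simp_all add: partial_single mult_single lookup_add 1 2 algebra_simps
        flip: single_add)
qed

lemma partial_mult: "partial i (p * q) = partial i p * q + p * partial i q"
proof (induction p rule: mpoly_induct)
  case (single a c)
  show ?case
  proof (induction q rule: mpoly_induct)
    case (single b d)
    show ?case by (rule partial_single_mult)
  next
    case (add p q)
    then show ?case by (simp add: distrib_left partial_add algebra_simps)
  qed
next
  case (add p q)
  then show ?case by (simp add: distrib_right partial_add algebra_simps)
qed

lemma keys_partial: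
  "m \<in> Poly_Mapping.keys (partial i p) \<Longrightarrow> m + Poly_Mapping.single i 1 \<in> Poly_Mapping.keys p"
  by (auto simp: in_keys_iff lookup_partial)

lemma keys_add_nat: "Poly_Mapping.keys (a + b :: 'a \<Rightarrow>\<^sub>0 nat) = Poly_Mapping.keys a \<union> Poly_Mapping.keys b"
  by (auto simp: in_keys_iff lookup_add)

lemma partial_in_polys: "p \<in> polys n \<Longrightarrow> partial i p \<in> polys n"
  unfolding polys_def using keys_partial[of _ i p] by (fastforce simp: keys_add_nat)

lemma partial_eq_0: "p \<in> polys j \<Longrightarrow> i > j \<Longrightarrow> partial i p = 0"
proof (rule ccontr)
  assume p: "p \<in> polys j" "i > j" and "partial i p \<noteq> 0"
  then obtain m where "m \<in> Poly_Mapping.keys (partial i p)"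
    by (metis keys_eq_empty all_not_in_conv)
  then have "m + Poly_Mapping.single i 1 \<in> Poly_Mapping.keys p"
    by (rule keys_partial)
  then show False
    using p by (fastforce simp: polys_def keys_add_nat)
qed

subsection \<open>Derivations are vector fields\<close>

lemma derivation_add:
  "D \<in> derivations n \<Longrightarrow> p \<in> polys n \<Longrightarrow> q \<in> polys n \<Longrightarrow> D (p + q) = D p + D q"
  by (simp add: derivations_def)

lemma derivation_mult:
  "D \<in> derivations n \<Longrightarrow> p \<in> polys n \<Longrightarrow> q \<in> polys n \<Longrightarrow> D (p * q) = D p * q + p * D q"
  by (simp add: derivations_def)

lemma derivation_pscale:
  "D \<in> derivations n \<Longrightarrow> p \<in> polys n \<Longrightarrow> D (pscale c p) = pscale c (D p)"
  by (simp add: derivations_def)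

lemma derivation_outside: "D \<in> derivations n \<Longrightarrow> p \<notin> polys n \<Longrightarrow> D p = 0"
  by (simp add: derivations_def)

lemma derivation_sum:
  assumes "D \<in> derivations n" "\<And>i. i \<in> A \<Longrightarrow> f i \<in> polys n"
  shows "D (sum f A) = (\<Sum>i\<in>A. D (f i))"
  using assms(2)
  by (induction A rule: infinite_finite_induct)
    (auto simp: derivation_0[OF assms(1)] derivation_add[OF assms(1)] polys_sum)

lemma derivation_1:
  assumes "D \<in> derivations n"
  shows "D 1 = 0"
proof -
  have "D 1 = D 1 + D 1"
    using derivation_mult[OF assms, of 1 1] by (simp only: one_in_polys mult_1_left mult_1_right)
  then show ?thesis
    by (simp only: add_cancel_right_right)
qed

lemma derivation_const:
  assumes "D \<in> derivations n"
  shows "D (pscale c 1) = 0"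
  using derivation_pscale[OF assms, of 1 c] derivation_1[OF assms] by (simp add: pscale_def)

lemma commutator_apply: "commutator D E p = D (E p) - E (D p)"
  by (simp add: commutator_def)

lemma oscale_apply: "oscale c D p = pscale c (D p)"
  by (simp add: oscale_def)

lemma vector_field_derivation:
  assumes "\<And>i. i \<in> {1..n} \<Longrightarrow> f i \<in> polys n"
  shows "vector_field n f \<in> derivations n"
  unfolding derivations_def mem_Collect_eq
proof (intro conjI ballI allI impI)
  fix p q :: "'a mpoly"
  assume p: "p \<in> polys n" and q: "q \<in> polys n"
  show "vector_field n f (p + q) = vector_field n f p + vector_field n f q"
    using p q by (simp add: vector_field_def polys_add partial_add distrib_left sum.distrib)
  show "vector_field n f (p * q) = vector_field n f p * q + p * vector_field n f q"
    using p q
    by (simp add: vector_field_def polys_mult partial_mult distrib_left sum.distrib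
        sum_distrib_left sum_distrib_right mult_ac)
next
  fix p :: "'a mpoly" assume "p \<in> polys n"
  then show "vector_field n f p \<in> polys n"
    by (auto simp: vector_field_def assms intro!: polys_sum polys_mult partial_in_polys)
next
  fix c and p :: "'a mpoly" assume "p \<in> polys n"
  then show "vector_field n f (pscale c p) = pscale c (vector_field n f p)"
    by (simp add: vector_field_def polys_pscale partial_pscale)
      (simp add: pscale_def sum_distrib_left mult_ac)
qed (simp add: vector_field_def)

lemma vector_field_var: "j \<in> {1..n} \<Longrightarrow> vector_field n f (var j) = f j"
  by (auto simp: vector_field_def var_in_polys partial_var if_distrib cong: if_cong)

text \<open>Induction on the total degree: split off one variable and apply the Leibniz
  rule.\<close>

lemma derivation_monomial_eq_0:
  fixes D :: "'k::field mpoly \<Rightarrow> 'k mpoly"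
  assumes D: "D \<in> derivations n" and var: "\<And>i. i \<in> {1..n} \<Longrightarrow> D (var i) = 0"
    and m: "Poly_Mapping.keys m \<subseteq> {1..n}"
  shows "D (Poly_Mapping.single m 1) = 0"
  using m
proof (induction "\<Sum>i=1..n. Poly_Mapping.lookup m i" arbitrary: m rule: less_induct)
  case less
  show ?case
  proof (cases "m = 0")
    case True
    then show ?thesis using derivation_1[OF D] by simp
  next
    case False
    then obtain i where i: "i \<in> Poly_Mapping.keys m"
      by (metis keys_eq_empty all_not_in_conv)
    define m' where "m' = m - Poly_Mapping.single i 1"
    have m: "m = Poly_Mapping.single i 1 + m'"
      using i unfolding m'_def
      by (intro poly_mapping_eqI) (auto simp: lookup_add lookup_minus lookup_single when_def in_keys_iff)
    have i_in: "i \<in> {1..n}"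
      using i less.prems by blast
    have m'_in: "Poly_Mapping.keys m' \<subseteq> {1..n}"
      using less.prems m by (simp add: keys_add_nat)
    have "(\<Sum>i=1..n. Poly_Mapping.lookup m' i) < (\<Sum>i=1..n. Poly_Mapping.lookup m i)"
      unfolding m using i_in
      by (simp add: lookup_add sum.distrib lookup_single when_def)
    then have "D (Poly_Mapping.single m' 1) = 0"
      using less.hyps m'_in by blast
    moreover have "Poly_Mapping.single m' (1::'k) \<in> polys n"
      using m'_in by (simp add: polys_def)
    moreover have "Poly_Mapping.single m (1::'k) = var i * Poly_Mapping.single m' 1"
      by (simp add: m var_def mult_single)
    ultimately show ?thesis
      using derivation_mult[OF D var_in_polys[OF i_in]] var[OF i_in] by simp
  qed
qed

text \<open>Linearity reduces the claim to monomials; outside \<open>polys n\<close> the extension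
  by zero settles it. Hence a derivation is determined by its values on the variables.\<close>

lemma derivation_eq_0:
  fixes D :: "'k::field mpoly \<Rightarrow> 'k mpoly"
  assumes D: "D \<in> derivations n" and var: "\<And>i. i \<in> {1..n} \<Longrightarrow> D (var i) = 0"
  shows "D = 0"
proof
  fix p
  show "D p = 0 p"
  proof (cases "p \<in> polys n")
    case False
    then show ?thesis using derivation_outside[OF D] by simp
  next
    case True
    have *: "D (Poly_Mapping.single m c) = 0" and **: "Poly_Mapping.single m c \<in> polys n"
      if "m \<in> Poly_Mapping.keys p"  for m and c :: 'k
    proof -
      have m: "Poly_Mapping.keys m \<subseteq> {1..n}"
        using that True by (auto simp: polys_def)
      then have "Poly_Mapping.single m (1::'k) \<in> polys n"
        by (simp add: polys_def)
      then have "D (pscale c (Poly_Mapping.single m 1)) = 0"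
        using derivation_monomial_eq_0[OF D var m] derivation_pscale[OF D]
        by (simp add: pscale_def)
      then show "D (Poly_Mapping.single m c) = 0"
        by (simp add: pscale_def mult_single)
      show "Poly_Mapping.single m c \<in> polys n"
        using m by (simp add: polys_def)
    qed
    have "D p = (\<Sum>m\<in>Poly_Mapping.keys p. D (Poly_Mapping.single m (Poly_Mapping.lookup p m)))"
      by (subst mpoly_eq_sum_single) (rule derivation_sum[OF D **])
    then show ?thesis
      by (simp add: *)
  qed
qed

lemma derivations_minus: "D \<in> derivations n \<Longrightarrow> E \<in> derivations n \<Longrightarrow> D - E \<in> derivations n"
  using derivations_add[of D n "oscale (-1) E"] derivations_oscale[of E n "-1"]
  by (simp add: oscale_def pscale_def fun_eq_iff single_uminus fun_diff_def plus_fun_def)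

lemma derivation_eqI:
  assumes "D \<in> derivations n" "E \<in> derivations n" "\<And>i. i \<in> {1..n} \<Longrightarrow> D (var i) = E (var i)"
  shows "D = E"
  using derivation_eq_0[OF derivations_minus[OF assms(1,2)]] assms(3) by simp

lemma derivation_eq_vector_field:
  assumes "D \<in> derivations n"
  shows "D = vector_field n (\<lambda>i. D (var i))"
  using assms
  by (intro derivation_eqI[of _ n] vector_field_derivation)
    (auto simp: vector_field_var derivation_in)

lemma derivation_expand:
  assumes "D \<in> derivations n" "p \<in> polys n"
  shows "D p = (\<Sum>i=1..n. D (var i) * partial i p)"
  by (subst derivation_eq_vector_field[OF assms(1)]) (simp add: vector_field_def assms(2))

lemma triangular_iff:
  "D \<in> triangular n \<longleftrightarrow> D \<in> derivations n \<and> (\<forall>i\<in>{1..n}. D (var i) \<in> polys (i - 1))"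
proof
  assume "D \<in> triangular n"
  then obtain f where f: "D = vector_field n f" "\<forall>i\<in>{1..n}. f i \<in> polys (i - 1)"
    by (auto simp: triangular_def)
  moreover have "f i \<in> polys n" if "i \<in> {1..n}" for i
    using f(2) that polys_mono[of "i - 1" n] by fastforce
  ultimately show "D \<in> derivations n \<and> (\<forall>i\<in>{1..n}. D (var i) \<in> polys (i - 1))"
    using vector_field_derivation[of n f] by (auto simp: vector_field_var)
next
  assume "D \<in> derivations n \<and> (\<forall>i\<in>{1..n}. D (var i) \<in> polys (i - 1))"
  then show "D \<in> triangular n"
    unfolding triangular_def using derivation_eq_vector_field by blast
qed

text \<open>In the expansion of \<open>D p\<close> only indices \<open>i \<le> j\<close> survive,
  and their coefficients lie in \<open>polys (i - 1)\<close>, inside \<open>polys j\<close>. This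
  makes the triangular derivations closed under commutators.\<close>

lemma triangular_preserves_polys:
  assumes D: "D \<in> triangular n" and p: "p \<in> polys j" and j: "j \<le> n"
  shows "D p \<in> polys j"
proof -
  have "D (var i) * partial i p \<in> polys j" if i: "i \<in> {1..n}" for i
  proof (cases "i \<le> j")
    case True
    then show ?thesis
      using D i p subsetD[OF polys_mono[of "i - 1" j], of "D (var i)"]
      by (auto simp: triangular_iff intro!: polys_mult partial_in_polys)
  next
    case False
    then show ?thesis using partial_eq_0[OF p] by simp
  qed
  moreover have "D \<in> derivations n" "p \<in> polys n"
    using D p polys_mono[OF j] by (auto simp: triangular_iff)
  ultimately show ?thesis
    by (auto simp: derivation_expand intro: polys_sum)
qed

lemma triangular_subalgebra: "W.subalgebra n (triangular n :: ('k::field mpoly \<Rightarrow> 'k mpoly) set)"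
  unfolding W.subalgebra_def
proof (intro conjI ballI)
  show "triangular n \<subseteq> derivations n"
    by (auto simp: triangular_iff)
  show "module.subspace oscale (triangular n :: ('k mpoly \<Rightarrow> 'k mpoly) set)"
    by (rule W.subspaceI)
      (auto simp: triangular_iff derivations_0 derivations_add derivations_oscale polys_add
        oscale_apply polys_pscale)
  fix D E :: "'k mpoly \<Rightarrow> 'k mpoly"
  assume D: "D \<in> triangular n" and E: "E \<in> triangular n"
  then have "D (E (var i)) \<in> polys (i - 1)" "E (D (var i)) \<in> polys (i - 1)" if "i \<in> {1..n}" for i
    using that triangular_preserves_polys[OF D, of "E (var i)" "i - 1"]
      triangular_preserves_polys[OF E, of "D (var i)" "i - 1"]
    by (auto simp: triangular_iff)
  then show "commutator D E \<in> triangular n"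
    using D E commutator_derivations[of D n E]
    by (auto simp: triangular_iff commutator_apply polys_diff)
qed


subsection \<open>Local nilpotency\<close>

text \<open>Constant weight 1 gives the total degree in the first \<open>n\<close> variables, the
  measure minimised in the maximality proof.\<close>

definition weight :: "(nat \<Rightarrow> nat) \<Rightarrow> nat \<Rightarrow> (nat \<Rightarrow>\<^sub>0 nat) \<Rightarrow> nat" where
  "weight w n m = (\<Sum>i=1..n. w i * Poly_Mapping.lookup m i)"

lemma weight_add: "weight w n (a + b) = weight w n a + weight w n b"
  by (simp add: weight_def lookup_add distrib_left sum.distrib)

lemma weight_single: "i \<in> {1..n} \<Longrightarrow> weight w n (Poly_Mapping.single i 1) = w i"
  by (simp add: weight_def lookup_single when_def if_distrib cong: if_cong)

lemma single_eq_single_iff: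
  "c \<noteq> 0 \<Longrightarrow> Poly_Mapping.single i c = Poly_Mapping.single j c \<longleftrightarrow> i = j"
  by (metis lookup_single_eq lookup_single_not_eq)

lemma weight_cong:
  "(\<And>i. i \<in> Poly_Mapping.keys m \<Longrightarrow> w i = w' i) \<Longrightarrow> weight w n m = weight w' n m"
  unfolding weight_def by (rule sum.cong) (auto simp: in_keys_iff)

text \<open>The weights are chosen one variable at a time: monomials in \<open>A i\<close> involve
  only variables before \<open>i\<close>, so \<open>w i\<close> may be made large after their
  weights are fixed.\<close>

lemma exists_weights:
  assumes fin: "\<And>i. finite (A i)"
    and keys: "\<And>i m. i \<in> {1..n} \<Longrightarrow> m \<in> A i \<Longrightarrow> Poly_Mapping.keys m \<subseteq> {1..i - 1}"
  shows "\<exists>w. \<forall>i\<in>{1..n}. \<forall>m\<in>A i. weight w n m < w i"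
proof -
  have "\<exists>w. \<forall>i\<in>{1..j}. \<forall>m\<in>A i. weight w n m < w i" if "j \<le> n" for j
    using that
  proof (induction j)
    case 0
    then show ?case by simp
  next
    case (Suc j)
    then obtain w where w: "\<forall>i\<in>{1..j}. \<forall>m\<in>A i. weight w n m < w i"
      by auto
    \<comment> \<open>The sum bounds every weight occurring in \<open>A (Suc j)\<close>, and
      \<open>Suc\<close> makes the bound strict.\<close>
    define w' where "w' = w(Suc j := Suc (\<Sum>m\<in>A (Suc j). weight w n m))"
    have eq: "weight w' n m = weight w n m" if "i \<in> {1..Suc j}" "m \<in> A i" for i m
    proof (rule weight_cong)
      fix l assume "l \<in> Poly_Mapping.keys m"
      then have "l < Suc j"
        using keys[of i m] that Suc.prems by fastforce
      then show "w' l = w l"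
        by (simp add: w'_def)
    qed
    have "weight w' n m < w' i" if i: "i \<in> {1..Suc j}" and m: "m \<in> A i" for i m
    proof (cases "i = Suc j")
      case True
      have "weight w n m \<le> (\<Sum>m\<in>A (Suc j). weight w n m)"
        using m fin True by (intro member_le_sum) auto
      then show ?thesis
        using eq[OF i m] True by (simp add: w'_def)
    next
      case False
      then show ?thesis
        using eq[OF i m] w i m by (auto simp: w'_def)
    qed
    then show ?case by blast
  qed
  then show ?thesis by blast
qed

text \<open>Replacing one factor \<open>var i\<close> by \<open>m\<close> lowers the weight by
  \<open>w i - weight w n m\<close>; the condition is stated additively because natural subtraction
  truncates.\<close>

definition weight_filtration ::
    "(nat \<Rightarrow> nat) \<Rightarrow> nat \<Rightarrow> nat \<Rightarrow> ('k::field mpoly \<Rightarrow> 'k mpoly) set" where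
  "weight_filtration w n d = {D \<in> derivations n.
     \<forall>i\<in>{1..n}. \<forall>m\<in>Poly_Mapping.keys (D (var i)). weight w n m + d \<le> w i}"

text \<open>A monomial of \<open>D p\<close> arises from one of \<open>p\<close> by trading a factor
  \<open>var i\<close> for a monomial of \<open>D (var i)\<close>, which costs at least
  \<open>d\<close>. The slack \<open>e\<close> lets the degrees of two derivations add up in a
  commutator.\<close>

lemma weight_filtration_lowers:
  assumes D: "D \<in> weight_filtration w n d" and p: "p \<in> polys n"
    and wt: "\<And>m. m \<in> Poly_Mapping.keys p \<Longrightarrow> weight w n m + e \<le> b"
    and m: "m \<in> Poly_Mapping.keys (D p)"
  shows "weight w n m + (d + e) \<le> b"
proof -
  have "D p = (\<Sum>i=1..n. D (var i) * partial i p)"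
    using D p by (intro derivation_expand) (auto simp: weight_filtration_def)
  then obtain i where i: "i \<in> {1..n}" and "m \<in> Poly_Mapping.keys (D (var i) * partial i p)"
    using m Poly_Mapping.keys_sum[of "\<lambda>i. D (var i) * partial i p" "{1..n}"] by auto
  then obtain a c where m_eq: "m = a + c" and a: "a \<in> Poly_Mapping.keys (D (var i))"
      and c: "c \<in> Poly_Mapping.keys (partial i p)"
    using Poly_Mapping.keys_mult[of "D (var i)" "partial i p"] by fast
  have "weight w n a + d \<le> w i"
    using D i a by (auto simp: weight_filtration_def)
  moreover have "weight w n c + w i + e \<le> b"
    using wt[OF keys_partial[OF c]] i by (simp only: weight_add weight_single)
  ultimately show ?thesis
    by (simp add: m_eq weight_add)
qed

lemma weight_filtration_commutator:
  assumes D: "D \<in> weight_filtration w n d" and E: "E \<in> weight_filtration w n e"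
  shows "commutator D E \<in> weight_filtration w n (d + e)"
proof -
  have der: "D \<in> derivations n" "E \<in> derivations n"
    using D E by (auto simp: weight_filtration_def)
  have "weight w n m + (d + e) \<le> w i"
    if i: "i \<in> {1..n}" and m: "m \<in> Poly_Mapping.keys (commutator D E (var i))" for i m
  proof -
    consider "m \<in> Poly_Mapping.keys (D (E (var i)))" | "m \<in> Poly_Mapping.keys (E (D (var i)))"
      using m Poly_Mapping.keys_diff[of "D (E (var i))" "E (D (var i))"]
      unfolding commutator_apply by blast
    then show ?thesis
    proof cases
      case 1
      then show ?thesis
        using weight_filtration_lowers[OF D derivation_in[OF der(2)], of "var i" e "w i"] E i
        by (auto simp: weight_filtration_def)
    next
      case 2
      then have "weight w n m + (e + d) \<le> w i"
        using weight_filtration_lowers[OF E derivation_in[OF der(1)], of "var i" d "w i"] D i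
        by (auto simp: weight_filtration_def)
      then show ?thesis by (simp add: add.commute)
    qed
  qed
  then show ?thesis
    using commutator_derivations[OF der] by (simp add: weight_filtration_def)
qed

lemma weight_filtration_subspace:
  "module.subspace oscale (weight_filtration w n d :: ('k::field mpoly \<Rightarrow> 'k mpoly) set)"
proof (rule W.subspaceI)
  fix D E :: "'k mpoly \<Rightarrow> 'k mpoly"
  assume "D \<in> weight_filtration w n d" "E \<in> weight_filtration w n d"
  then show "D + E \<in> weight_filtration w n d"
    using Poly_Mapping.keys_add
    by (fastforce simp: weight_filtration_def intro: derivations_add)
next
  fix D :: "'k mpoly \<Rightarrow> 'k mpoly" and c
  assume "D \<in> weight_filtration w n d"
  then show "oscale c D \<in> weight_filtration w n d"
    using keys_pscale derivations_oscale[of D n c]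
    by (fastforce simp: weight_filtration_def oscale_apply)
qed (auto simp: weight_filtration_def derivations_0)

lemma weight_filtration_antimono:
  "d \<le> e \<Longrightarrow> weight_filtration w n e \<subseteq> weight_filtration w n d"
  by (fastforce simp: weight_filtration_def)

text \<open>Weights are nonnegative, so no monomial can lie \<open>d\<close> below a variable of
  weight less than \<open>d\<close>.\<close>

lemma weight_filtration_eq_0:
  assumes "\<And>i. i \<in> {1..n} \<Longrightarrow> w i < d"
  shows "weight_filtration w n d = {0}"
proof -
  have "D = 0" if D: "D \<in> weight_filtration w n d" for D :: "'a mpoly \<Rightarrow> 'a mpoly"
  proof (rule derivation_eq_0)
    show "D \<in> derivations n"
      using D by (simp add: weight_filtration_def)
    fix i assume i: "i \<in> {1..n}"
    then have "Poly_Mapping.keys (D (var i)) = {}"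
      using D assms[OF i] by (fastforce simp: weight_filtration_def)
    then show "D (var i) = 0" by simp
  qed
  moreover have "0 \<in> weight_filtration w n d"
    by (rule W.subspace_0[OF weight_filtration_subspace])
  ultimately show ?thesis by blast
qed

lemma triangular_locally_nilpotent:
  "W.locally_nilpotent n (triangular n :: ('k::field mpoly \<Rightarrow> 'k mpoly) set)"
  unfolding W.locally_nilpotent_def
proof (intro allI impI, elim conjE)
  fix X :: "('k mpoly \<Rightarrow> 'k mpoly) set"
  assume fin: "finite X" and X: "X \<subseteq> triangular n"
  have "\<exists>w. \<forall>i\<in>{1..n}. \<forall>m\<in>(\<Union>D\<in>X. Poly_Mapping.keys (D (var i))). weight w n m < w i"
  proof (rule exists_weights)
    fix i m assume i: "i \<in> {1..n}" and "m \<in> (\<Union>D\<in>X. Poly_Mapping.keys (D (var i)))"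
    then obtain D where "D \<in> X" and m: "m \<in> Poly_Mapping.keys (D (var i))"
      by blast
    then have "D (var i) \<in> polys (i - 1)"
      using X i subsetD[OF X] by (simp add: triangular_iff)
    then show "Poly_Mapping.keys m \<subseteq> {1..i - 1}"
      using m by (rule polysD)
  qed (simp add: fin)
  then obtain w where "\<forall>i\<in>{1..n}. \<forall>D\<in>X. \<forall>m\<in>Poly_Mapping.keys (D (var i)). weight w n m < w i"
    by blast
  \<comment> \<open>For natural weights, strict decrease means a drop of at least 1.\<close>
  then have XF: "X \<subseteq> weight_filtration w n 1"
    using X by (fastforce simp: weight_filtration_def triangular_iff)
  have "W.subalgebra n (weight_filtration w n 1 :: ('k mpoly \<Rightarrow> 'k mpoly) set)"
    unfolding W.subalgebra_def
  proof (intro conjI ballI)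
    show "weight_filtration w n 1 \<subseteq> derivations n"
      by (auto simp: weight_filtration_def)
    show "commutator D E \<in> weight_filtration w n 1"
      if "D \<in> weight_filtration w n 1" "E \<in> weight_filtration w n 1" for D E
      using weight_filtration_commutator[OF that] weight_filtration_antimono[of 1 "1 + 1" w n]
      by auto
  qed (rule weight_filtration_subspace)
  then have gen: "W.generated n X \<subseteq> weight_filtration w n 1"
    unfolding W.generated_def using XF by (intro hull_minimal) auto
  have "W.subalgebra n (W.generated n X)"
    using X by (intro W.subalgebra_generated) (auto simp: triangular_iff)
  then have "module.subspace oscale (W.generated n X)"
    by (simp add: W.subalgebra_def)
  moreover have "weight_filtration w n (Suc (\<Sum>i=1..n. w i)) = {0 :: 'k mpoly \<Rightarrow> 'k mpoly}"
    by (intro weight_filtration_eq_0) (simp add: less_Suc_eq_le member_le_sum)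
  ultimately show "W.nilpotent (W.generated n X)"
    using gen weight_filtration_subspace weight_filtration_commutator
    by (intro W.nilpotent_filtration[of "weight_filtration w n"])
qed

subsection \<open>Maximality\<close>

text \<open>For \<open>k\<close> in \<open>{1..n}\<close> this is \<open>partial k\<close>, cut off
  to zero outside \<open>polys n\<close> so that it is an element of
  \<open>derivations n\<close>.\<close>

definition coord_field :: "nat \<Rightarrow> nat \<Rightarrow> 'k::field mpoly \<Rightarrow> 'k mpoly" where
  "coord_field n k = vector_field n (\<lambda>i. if i = k then 1 else 0)"

lemma coord_field_triangular: "coord_field n k \<in> triangular n"
  by (auto simp: coord_field_def triangular_def)

lemma coord_field_var:
  "j \<in> {1..n} \<Longrightarrow> coord_field n k (var j) = (if j = k then 1 else 0)"
  by (simp add: coord_field_def vector_field_var)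

lemma coord_field_eq_partial:
  "p \<in> polys n \<Longrightarrow> k \<in> {1..n} \<Longrightarrow> coord_field n k p = partial k p"
  by (auto simp: coord_field_def vector_field_def if_distrib[of "\<lambda>x. x * _"] cong: if_cong)

lemma commutator_coord_field_var:
  assumes "D \<in> derivations n" "j \<in> {1..n}" "k \<in> {1..n}"
  shows "commutator D (coord_field n k) (var j) = - partial k (D (var j))"
  using assms
  by (simp add: commutator_apply coord_field_var coord_field_eq_partial derivation_in
      derivation_0 derivation_1)

text \<open>If \<open>m\<close> had a further factor \<open>var k\<close> beside
  \<open>var i\<close>, differentiating by \<open>i\<close> would force \<open>k \<le> r\<close>, so
  \<open>k\<close> differs from \<open>i\<close>; differentiating by \<open>k\<close> then leaves
  \<open>var i\<close> in a polynomial of \<open>polys r\<close>, although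
  \<open>i > r\<close>.\<close>

lemma affine_monomials:
  fixes p :: "'k::field_char_0 mpoly"
  assumes par: "\<And>i. i \<in> {1..n} \<Longrightarrow> partial i p \<in> polys r"
    and p: "p \<in> polys n" and m: "m \<in> Poly_Mapping.keys p"
    and i: "i \<in> Poly_Mapping.keys m" "i > r"
  shows "m = Poly_Mapping.single i 1"
proof (rule ccontr)
  assume ne: "m \<noteq> Poly_Mapping.single i 1"
  have keys: "Poly_Mapping.keys (m - Poly_Mapping.single k 1) \<subseteq> {1..r}"
      and dec: "m = m - Poly_Mapping.single k 1 + Poly_Mapping.single k 1"
    if k: "k \<in> Poly_Mapping.keys m" for k
  proof -
    show dec: "m = m - Poly_Mapping.single k 1 + Poly_Mapping.single k 1"
      using k by (intro poly_mapping_eqI)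
        (auto simp: lookup_add lookup_minus lookup_single when_def in_keys_iff)
    \<comment> \<open>Characteristic zero enters here: the exponent factor produced by
      differentiation is a nonzero scalar.\<close>
    have "m - Poly_Mapping.single k 1 \<in> Poly_Mapping.keys (partial k p)"
      using m by (simp add: in_keys_iff lookup_partial dec[symmetric] del: of_nat_Suc One_nat_def)
    moreover have "k \<in> {1..n}"
      using polysD[OF p m] k by blast
    ultimately show "Poly_Mapping.keys (m - Poly_Mapping.single k 1) \<subseteq> {1..r}"
      using par[of k] by (auto simp: polys_def)
  qed
  have "m - Poly_Mapping.single i 1 \<noteq> 0"
    using dec[OF i(1)] ne by (metis add_0_left)
  then obtain k where k: "k \<in> Poly_Mapping.keys (m - Poly_Mapping.single i 1)"
    by (metis keys_eq_empty all_not_in_conv)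
  then have "k \<le> r"
    using keys[OF i(1)] by auto
  moreover have "k \<in> Poly_Mapping.keys m"
    using k arg_cong[OF dec[OF i(1)], of Poly_Mapping.keys] unfolding keys_add_nat by blast
  ultimately have "i \<in> Poly_Mapping.keys (m - Poly_Mapping.single k 1)"
    using i by (simp add: in_keys_iff lookup_minus lookup_single)
  then show False
    using keys[OF \<open>k \<in> Poly_Mapping.keys m\<close>] i by auto
qed

text \<open>Up to sign, the bracket with \<open>coord_field n k\<close> differentiates the
  coefficients, so it lowers the degree while staying in \<open>S\<close>; minimality of the degree
  outside the triangular algebra then applies.\<close>

lemma exists_commuting_mod_triangular:
  fixes S :: "('k::field mpoly \<Rightarrow> 'k mpoly) set"
  assumes S: "W.subalgebra n S" and U: "triangular n \<subset> S"
  obtains D where "D \<in> S" "D \<notin> triangular n"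
    "\<And>k. k \<in> {1..n} \<Longrightarrow> commutator D (coord_field n k) \<in> triangular n"
proof -
  have der: "D \<in> derivations n" if "D \<in> S" for D
    using S that by (auto simp: W.subalgebra_def)
  define P where "P d \<longleftrightarrow> (\<exists>D\<in>S - triangular n. \<forall>j\<in>{1..n}.
    \<forall>m\<in>Poly_Mapping.keys (D (var j)). weight (\<lambda>_. 1) n m < d)" for d
  obtain D0 where D0: "D0 \<in> S - triangular n"
    using U by blast
  have "P (Suc (\<Sum>j=1..n. \<Sum>m\<in>Poly_Mapping.keys (D0 (var j)). weight (\<lambda>_. 1) n m))"
    unfolding P_def less_Suc_eq_le
  proof (intro bexI[OF _ D0] ballI)
    fix j m assume j: "j \<in> {1..n}" and m: "m \<in> Poly_Mapping.keys (D0 (var j))"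
    have "weight (\<lambda>_. 1) n m \<le> (\<Sum>m\<in>Poly_Mapping.keys (D0 (var j)). weight (\<lambda>_. 1) n m)"
      using m by (intro member_le_sum) auto
    also have "\<dots> \<le> (\<Sum>j=1..n. \<Sum>m\<in>Poly_Mapping.keys (D0 (var j)). weight (\<lambda>_. 1) n m)"
      using j by (intro member_le_sum) auto
    finally show "weight (\<lambda>_. 1) n m \<le>
      (\<Sum>j=1..n. \<Sum>m\<in>Poly_Mapping.keys (D0 (var j)). weight (\<lambda>_. 1) n m)" .
  qed
  then have "P (LEAST d. P d)"
    by (rule LeastI)
  moreover define d where "d = (LEAST d. P d)"
  ultimately have "P d" and min: "\<And>e. P e \<Longrightarrow> d \<le> e"
    by (auto intro: Least_le)
  then obtain D where D: "D \<in> S" "D \<notin> triangular n"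
    and d: "\<And>j m. j \<in> {1..n} \<Longrightarrow> m \<in> Poly_Mapping.keys (D (var j)) \<Longrightarrow> weight (\<lambda>_. 1) n m < d"
    unfolding P_def by blast
  have "commutator D (coord_field n k) \<in> triangular n" if k: "k \<in> {1..n}" for k
  proof (rule ccontr)
    assume "commutator D (coord_field n k) \<notin> triangular n"
    moreover have "commutator D (coord_field n k) \<in> S"
      using S D subsetD[OF psubset_imp_subset[OF U] coord_field_triangular]
      by (simp add: W.subalgebra_def)
    moreover have "weight (\<lambda>_. 1) n m < d - 1"
      if j: "j \<in> {1..n}" and "m \<in> Poly_Mapping.keys (commutator D (coord_field n k) (var j))" for j m
    proof -
      have "m \<in> Poly_Mapping.keys (partial k (D (var j)))"
        using that(2) by (simp add: commutator_coord_field_var[OF der[OF D(1)] j k] in_keys_iff)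
      from d[OF j keys_partial[OF this]] have "weight (\<lambda>_. 1) n m + 1 < d"
        using k by (simp only: weight_add weight_single)
      then show ?thesis by simp
    qed
    ultimately have "P (d - 1)"
      unfolding P_def by blast
    \<comment> \<open>At \<open>d = 0\<close> the truncated \<open>d - 1\<close> would contradict
      nothing. Since the bound in \<open>P\<close> is strict, \<open>d = 0\<close> would mean that
      \<open>D\<close> kills all variables and is thus triangular.\<close>
    moreover have "d > 0"
    proof (rule ccontr)
      assume "\<not> d > 0"
      then have "D (var j) = 0" if "j \<in> {1..n}" for j
        using d[OF that] by (metis keys_eq_empty all_not_in_conv not_less_zero gr0I)
      then show False
        using D der by (simp add: triangular_iff)
    qed
    ultimately show False
      using min[of "d - 1"] by simp
  qed
  then show thesis
    using that D by blast
qed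

section \<open>Linear vector fields\<close>

lemma pscale_pscale: "pscale c (pscale d p) = pscale (c * d) p"
  by (rule poly_mapping_eqI) (simp add: lookup_pscale mult.assoc)

lemma sum_pscale: "(\<Sum>i\<in>A. pscale (f i) p) = pscale (\<Sum>i\<in>A. f i) p"
  by (rule poly_mapping_eqI) (simp add: lookup_pscale lookup_sum sum_distrib_right)

lemma pscale_minus: "- pscale c p = pscale (- c) p"
  by (rule poly_mapping_eqI) (simp add: lookup_pscale)

lemma pscale_0 [simp]: "pscale 0 p = 0" "pscale c 0 = 0"
  by (simp_all add: pscale_def)

lemma pscale_one_eq_0_iff [simp]: "pscale c 1 = 0 \<longleftrightarrow> c = 0"
  by (metis lookup_one_zero lookup_pscale lookup_zero mult.right_neutral pscale_0(1))

lemma derivation_linear_form: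
  assumes "D \<in> derivations n" "A \<subseteq> {1..n}"
  shows "D (\<Sum>i\<in>A. pscale (c i) (var i)) = (\<Sum>i\<in>A. pscale (c i) (D (var i)))"
proof -
  have *: "var i \<in> polys n" if "i \<in> A" for i
    using that assms(2) by (intro var_in_polys) blast
  have "D (\<Sum>i\<in>A. pscale (c i) (var i)) = (\<Sum>i\<in>A. D (pscale (c i) (var i)))"
    by (rule derivation_sum[OF assms(1) polys_pscale[OF *]])
  also have "\<dots> = (\<Sum>i\<in>A. pscale (c i) (D (var i)))"
    by (rule sum.cong) (auto intro: derivation_pscale[OF assms(1) *])
  finally show ?thesis .
qed

lemma upper_triangular_linear_eq_0:
  fixes S :: "('k::field mpoly \<Rightarrow> 'k mpoly) set"
  assumes S: "W.subalgebra n S" "W.locally_nilpotent n S" and U: "triangular n \<subseteq> S"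
    and E: "E \<in> S"
    and lin: "\<And>j. j \<in> {1..n} \<Longrightarrow> E (var j) = (\<Sum>i=j..n. pscale (a i j) (var i))"
  shows "E = 0"
proof (rule ccontr)
  assume "E \<noteq> 0"
  have der: "D \<in> derivations n" if "D \<in> S" for D
    using S that by (auto simp: W.subalgebra_def)
  have comm: "commutator D D' \<in> S" if "D \<in> S" "D' \<in> S" for D D'
    using S that by (auto simp: W.subalgebra_def)
  note E' = der[OF E]
  \<comment> \<open>\<open>Q k\<close> says that \<open>var k\<close> occurs in some
    \<open>E (var j)\<close>; the range \<open>{1..k}\<close> is empty at 0, so \<open>Q k\<close>
    entails \<open>k \<ge> 1\<close>.\<close>
  define Q where "Q k \<longleftrightarrow> k \<le> n \<and> (\<exists>j\<in>{1..k}. a k j \<noteq> 0)" for k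
  have "\<exists>k. Q k"
  proof (rule ccontr)
    assume "\<nexists>k. Q k"
    then have "E (var j) = 0" if "j \<in> {1..n}" for j
      using that unfolding lin[OF that] by (intro sum.neutral) (auto simp: Q_def)
    then show False
      using derivation_eq_0[OF E'] \<open>E \<noteq> 0\<close> by blast
  qed
  then have Qk: "Q (LEAST k. Q k)"
    by (rule LeastI_ex)
  define k where "k = (LEAST k. Q k)"
  have k: "k \<in> {1..n}"
    using Qk by (auto simp: Q_def k_def)
  have least: "a i j = 0" if "i < k" "j \<in> {1..i}" for i j
    using not_less_Least[of i Q] that k by (auto simp: Q_def k_def)
  define dk where "dk = (coord_field n k :: 'k mpoly \<Rightarrow> 'k mpoly)"
  have dk_S: "dk \<in> S"
    using U coord_field_triangular by (auto simp: dk_def)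
  have partial_E: "partial k (E (var j)) = pscale (if j \<le> k then a k j else 0) 1"
    if "j \<in> {1..n}" for j
  proof -
    have "partial k (E (var j)) = (\<Sum>i=j..n. if i = k then pscale (a k j) 1 else 0)"
      unfolding lin[OF that] partial_sum
      by (rule sum.cong) (auto simp: partial_pscale partial_var)
    then show ?thesis
      using k by auto
  qed
  \<comment> \<open>Differentiating linear coefficients leaves constants: \<open>w\<close> is the
    constant field with components \<open>- a k j\<close> for \<open>j \<le> k\<close>, and
    \<open>E\<close> annihilates these.\<close>
  define w where "w = commutator E dk"
  have w_S: "w \<in> S"
    by (simp add: w_def comm E dk_S)
  have w_var: "w (var j) = pscale (if j \<le> k then - a k j else 0) 1" if "j \<in> {1..n}" for j
    using that k by (simp add: w_def dk_def commutator_coord_field_var E' partial_E pscale_minus)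
  have E_w_var: "E (w (var j)) = 0" if "j \<in> {1..n}" for j
    unfolding w_var[OF that] by (rule derivation_const[OF E'])
  have w_E: "w (E (var j)) = pscale (if j \<le> k then - (a k j * a k k) else 0) 1"
    if j: "j \<in> {1..n}" for j
  proof -
    have "w (E (var j)) = (\<Sum>i=j..n. pscale (a i j * (if i \<le> k then - a k i else 0)) 1)"
      unfolding lin[OF j] using j
      by (subst derivation_linear_form[OF der[OF w_S]])
        (auto simp: w_var pscale_pscale intro!: sum.cong)
    \<comment> \<open>Terms with \<open>i > k\<close> vanish because \<open>w\<close> kills
      \<open>var i\<close>, those with \<open>i < k\<close> by minimality of
      \<open>k\<close>.\<close>
    also have "\<dots> = pscale (\<Sum>i=j..n. if i = k then - (a k j * a k k) else 0) 1"
      unfolding sum_pscale using j least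
      by (intro arg_cong[where f = "\<lambda>x. pscale x 1"] sum.cong) auto
    finally show ?thesis
      using k by simp
  qed
  show False
  proof (cases "a k k = 0")
    case False
    have Ew: "commutator E w = oscale (- a k k) w"
    proof (rule derivation_eqI)
      show "commutator E w \<in> derivations n" "oscale (- a k k) w \<in> derivations n"
        by (intro der comm E w_S derivations_oscale)+
      fix j assume j: "j \<in> {1..n}"
      show "commutator E w (var j) = oscale (- a k k) w (var j)"
        unfolding commutator_apply oscale_apply E_w_var[OF j] w_E[OF j]
        by (simp add: w_var[OF j] pscale_pscale pscale_minus mult.commute)
    qed
    \<comment> \<open>The eigenvalue is squared to match the criterion for the square of
      \<open>ad E\<close>.\<close>
    then have "commutator E (commutator E w) = oscale (- a k k) (oscale (- a k k) w)"
      using W.bracket_scale_right[OF E' der[OF w_S], of "- a k k"] by simp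
    then have "commutator E (commutator E w) = oscale (a k k * a k k) w"
      by simp
    then have "w = 0"
      by (rule W.locally_nilpotent_ad2_eigen[OF S E w_S]) (simp add: False)
    then show False
      using w_var[OF k] False by simp
  next
    case True
    obtain l where l: "l \<in> {1..k}" "a k l \<noteq> 0"
      using Qk by (auto simp: Q_def k_def)
    with True have "l < k"
      by (cases "l = k") auto
    \<comment> \<open>Now \<open>E\<close> commutes with \<open>w\<close>, so a triangular
      correction is added to bring \<open>w\<close> back to \<open>dk\<close>. The field
      \<open>M\<close> commutes with \<open>dk\<close>, since \<open>l < k\<close>, and its bracket
      with \<open>w\<close> is \<open>a k l\<close> times \<open>dk\<close>.\<close>
    define M :: "'k mpoly \<Rightarrow> 'k mpoly" where "M = vector_field n (\<lambda>j. if j = k then var l else 0)"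
    have M_tri: "M \<in> triangular n"
      unfolding triangular_def M_def using l(1) \<open>l < k\<close> by (auto intro!: exI var_in_polys)
    have M_var: "M (var j) = (if j = k then var l else 0)" if "j \<in> {1..n}" for j
      using that by (simp add: M_def vector_field_var)
    have EM: "E + M \<in> S"
      using S E M_tri U by (auto simp: W.subalgebra_def intro: W.subspace_add)
    have w_eq: "commutator (E + M) dk = w"
    proof (rule derivation_eqI)
      show "commutator (E + M) dk \<in> derivations n" "w \<in> derivations n"
        by (intro der comm EM dk_S w_S)+
      fix j assume j: "j \<in> {1..n}"
      have "commutator (E + M) dk (var j) = - partial k (E (var j) + M (var j))"
        using j k by (simp add: dk_def commutator_coord_field_var der[OF EM])
      moreover have "partial k (M (var j)) = 0"
        using j \<open>l < k\<close> by (simp add: M_var partial_var)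
      ultimately show "commutator (E + M) dk (var j) = w (var j)"
        using j k by (simp add: w_def dk_def commutator_coord_field_var E' partial_add)
    qed
    have "commutator (E + M) (commutator (E + M) dk) = oscale (a k l) dk"
      unfolding w_eq
    proof (rule derivation_eqI)
      show "commutator (E + M) w \<in> derivations n" "oscale (a k l) dk \<in> derivations n"
        by (intro der comm EM w_S derivations_oscale dk_S)+
      fix j assume j: "j \<in> {1..n}"
      have "(E + M) (w (var j)) = 0"
        unfolding w_var[OF j] by (rule derivation_const[OF der[OF EM]])
      moreover have "w ((E + M) (var j)) = w (E (var j)) + w (M (var j))"
        using derivation_add[OF der[OF w_S] derivation_in[OF E'] derivation_in[of M n]] M_tri
        by (simp add: triangular_iff)
      moreover have "w (E (var j)) = 0"
        using w_E[OF j] True by simp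
      moreover have "w (M (var j)) = (if j = k then pscale (- a k l) 1 else 0)"
        using M_var[OF j] w_var[of l] l k derivation_0[OF der[OF w_S]] by auto
      ultimately show "commutator (E + M) w (var j) = oscale (a k l) dk (var j)"
        using j by (simp add: commutator_apply oscale_apply dk_def coord_field_var pscale_minus)
    qed
    then have "dk = 0"
      using l by (intro W.locally_nilpotent_ad2_eigen[OF S EM dk_S])
    then have "dk (var k) = 0"
      by simp
    then show False
      using k by (simp add: dk_def coord_field_var)
  qed
qed

text \<open>The nontriangular part of \<open>D\<close> is a linear field \<open>E\<close>. It lies
  in \<open>S\<close> because \<open>D - E\<close> is triangular, so it vanishes and
  \<open>D\<close> itself is triangular.\<close>

lemma triangular_maximal:
  fixes S :: "('k::field_char_0 mpoly \<Rightarrow> 'k mpoly) set"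
  assumes S: "W.subalgebra n S" "W.locally_nilpotent n S" and U: "triangular n \<subset> S"
  shows False
proof -
  obtain D where D: "D \<in> S" "D \<notin> triangular n"
    and comm: "\<And>k. k \<in> {1..n} \<Longrightarrow> commutator D (coord_field n k) \<in> triangular n"
    using exists_commuting_mod_triangular[OF S(1) U] by blast
  have D': "D \<in> derivations n"
    using S D by (auto simp: W.subalgebra_def)
  define a where "a i j = Poly_Mapping.lookup (D (var j)) (Poly_Mapping.single i 1)" for i j
  \<comment> \<open>Starting the sum at \<open>j\<close> collects exactly the linear terms of
    \<open>D (var j)\<close> that triangularity forbids.\<close>
  define f where "f j = (\<Sum>i=j..n. pscale (a i j) (var i))" for j
  define E where "E = vector_field n f"
  have f_in: "f j \<in> polys n" if "j \<in> {1..n}" for j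
    unfolding f_def using that by (auto intro!: polys_sum polys_pscale var_in_polys)
  then have E: "E \<in> derivations n"
    unfolding E_def by (rule vector_field_derivation)
  have E_var: "E (var j) = f j" if "j \<in> {1..n}" for j
    using that by (simp add: E_def vector_field_var)
  have lookup_f: "Poly_Mapping.lookup (f j) m =
      (\<Sum>i=j..n. if m = Poly_Mapping.single i 1 then a i j else 0)" for j m
    unfolding f_def lookup_sum
    by (rule sum.cong) (auto simp: lookup_pscale var_def lookup_single when_def)
  have "(D - E) (var j) \<in> polys (j - 1)" if j: "j \<in> {1..n}" for j
    unfolding polys_def mem_Collect_eq
  proof (intro ballI, rule ccontr)
    fix m assume m: "m \<in> Poly_Mapping.keys ((D - E) (var j))"
      and "\<not> Poly_Mapping.keys m \<subseteq> {1..j - 1}"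
    moreover have "(D - E) (var j) \<in> polys n"
      using derivation_in[OF derivations_minus[OF D' E]] .
    ultimately obtain i where i: "i \<in> Poly_Mapping.keys m" "i > j - 1" "i \<in> {1..n}"
      by (fastforce simp: polys_def)
    have par: "partial k (D (var j)) \<in> polys (j - 1)" if k: "k \<in> {1..n}" for k
      using comm[OF k] j k by (auto simp: triangular_iff commutator_coord_field_var D' polys_def)
    have "m = Poly_Mapping.single i 1"
    proof (cases "m \<in> Poly_Mapping.keys (D (var j))")
      case True
      then show ?thesis
        using affine_monomials[OF par derivation_in[OF D']] i by blast
    next
      case False
      \<comment> \<open>A monomial absent from \<open>D (var j)\<close> must come from
        \<open>f j\<close>, whose monomials are single variables.\<close>
      then have "Poly_Mapping.lookup (f j) m \<noteq> 0"
        using m E_var[OF j] by (auto simp: in_keys_iff lookup_minus)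
      then obtain i' where "m = Poly_Mapping.single i' 1"
        unfolding lookup_f by (rule sum.not_neutral_contains_not_neutral) (auto split: if_splits)
      then show ?thesis using i by auto
    qed
    \<comment> \<open>Since \<open>i \<ge> j\<close>, the variable is within the range of
      \<open>f j\<close>, and its coefficient cancels that in \<open>D (var j)\<close>.\<close>
    then have "Poly_Mapping.lookup (f j) m = a i j"
      unfolding lookup_f using i j by (auto simp: single_eq_single_iff)
    then show False
      using m E_var[OF j] \<open>m = Poly_Mapping.single i 1\<close>
      by (simp add: in_keys_iff lookup_minus a_def)
  qed
  then have DE: "D - E \<in> triangular n"
    using derivations_minus[OF D' E] by (simp add: triangular_iff)
  have "D - (D - E) \<in> S"
  proof (rule W.subspace_diff)
    show "module.subspace oscale S"
      using S by (simp add: W.subalgebra_def)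
  qed (use D DE U in auto)
  then have "E \<in> S"
    by simp
  then have "E = 0"
    using upper_triangular_linear_eq_0[OF S psubset_imp_subset[OF U], of E a] E_var
    by (simp add: f_def)
  then show False
    using DE D by simp
qed

theorem theorem1:
  fixes n :: nat
    and U :: "('k::{alg_closed_field, field_char_0} mpoly \<Rightarrow> 'k mpoly) set"
  assumes "n \<ge> 1" and "U = triangular n"
  shows "W.subalgebra n U \<and> W.locally_nilpotent n U \<and>
    \<not> (\<exists>S. W.subalgebra n S \<and> W.locally_nilpotent n S \<and> U \<subset> S)"
  using triangular_subalgebra triangular_locally_nilpotent triangular_maximal assms(2) by blast

end
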